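(* Let $C\colon T\rightrightarrows X$ be an admissible multifunction and let $A\in\mathcal{A}$. If $C$ takes nonempty values on $A$, then there exists a strongly measurable function $x\colon A\to X$ such that $x(t)\in C(t)$ for $\mu$-a.e. $t\in A$.
   Context: Standing assumptions: $X$ is a (not necessarily separable) Banach space, $(T,d)$ is a metric space, and $(T,\mathcal{A},\mu)$ is a complete $\sigma$-finite measure space with $\mathcal{A}$ containing the Borel $\sigma$-algebra of $T$; $\mu$ is inner regular, meaning that for all $\varepsilon>0$ and $B\in\mathcal{A}$ of finite measure there is a compact $K\subset B$ with $\mu(B\setminus K)<\varepsilon$. A function is strongly measurable if it is the pointwise limit of simple functions. A multifunction $\Phi$ is lower semicontinuous (lsc) at $t$ if for every open $V$ with $\Phi(t)\cap V\ne\emptyset$ there is a neighbourhood $U$ of $t$ with $\Phi(s)\cap V\neq\emptyset$ for all $s\in U$; it is lsc if it is lsc at every point where its value is nonempty. A family of multifunctions $(C_i\colon T\rightrightarrows X)_{i\in I}$ is a uniform family of Lusin multifunctions if for every $\varepsilon>0$ and $A\in\mathcal{A}$ of finite measure there is a compact $B\subset A$ with $\mu(A\setminus B)<\varepsilon$ such that $B\ni t\rightrightarrows C_i(t)$ is lsc for all $i\in I$. A multifunction $C\colon T\rightrightarrows X$ is admissible if there is a uniform family of Lusin multifunctions $(C_i\colon T\rightrightarrows X)_{i\in I}$ with closed and convex values such that $C(t)=\operatorname{cl}\big(\bigcup_{i\in I}C_i(t)\big)$ for all $t\in T$. *)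

theory Defs
  imports "HOL-Analysis.Analysis"
begin

text \<open>
  A multifunction from T to X is a total function of type \<open>'a \<Rightarrow> 'b set\<close>; the empty set is
  an allowed value.
\<close>

text \<open>
  Strong measurability on the measurable space underlying \<open>M\<close>.  For a function defined on a
  measurable subset \<open>A\<close>, take \<open>restrict_space M A\<close> for \<open>M\<close>.
\<close>

definition strongly_measurable :: "'a measure \<Rightarrow> ('a \<Rightarrow> 'b::topological_space) \<Rightarrow> bool" where
  "strongly_measurable M f \<longleftrightarrow>
     (\<exists>s :: nat \<Rightarrow> 'a \<Rightarrow> 'b. (\<forall>n. simple_function M (s n)) \<and>
        (\<forall>t\<in>space M. (\<lambda>n. s n t) \<longlonglongrightarrow> f t))"

text \<open>
  Lower semicontinuity of the restriction of \<open>\<Phi>\<close> to \<open>B\<close>: neighbourhoods are taken in the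
  subspace topology of \<open>B\<close>.
\<close>

definition lsc_at_within ::
  "('a::topological_space \<Rightarrow> 'b::topological_space set) \<Rightarrow> 'a set \<Rightarrow> 'a \<Rightarrow> bool" where
  "lsc_at_within \<Phi> B t \<longleftrightarrow>
     (\<forall>V. open V \<and> \<Phi> t \<inter> V \<noteq> {} \<longrightarrow>
        (\<exists>U. openin (top_of_set B) U \<and> t \<in> U \<and> (\<forall>s\<in>U. \<Phi> s \<inter> V \<noteq> {})))"

definition lsc_on ::
  "'a set \<Rightarrow> ('a::topological_space \<Rightarrow> 'b::topological_space set) \<Rightarrow> bool" where
  "lsc_on B \<Phi> \<longleftrightarrow> (\<forall>t\<in>B. \<Phi> t \<noteq> {} \<longrightarrow> lsc_at_within \<Phi> B t)"

definition inner_regular_measure :: "'a::topological_space measure \<Rightarrow> bool" where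
  "inner_regular_measure M \<longleftrightarrow>
     (\<forall>\<epsilon>::real. \<epsilon> > 0 \<longrightarrow> (\<forall>B\<in>sets M. emeasure M B < \<infinity> \<longrightarrow>
        (\<exists>K. compact K \<and> K \<subseteq> B \<and> emeasure M (B - K) < ennreal \<epsilon>)))"

definition uniform_Lusin_family ::
  "'a::topological_space measure \<Rightarrow> 'i set \<Rightarrow> ('i \<Rightarrow> 'a \<Rightarrow> 'b::topological_space set) \<Rightarrow> bool" where
  "uniform_Lusin_family M I Ci \<longleftrightarrow>
     (\<forall>\<epsilon>::real. \<epsilon> > 0 \<longrightarrow> (\<forall>A\<in>sets M. emeasure M A < \<infinity> \<longrightarrow>
        (\<exists>B. compact B \<and> B \<subseteq> A \<and> emeasure M (A - B) < ennreal \<epsilon> \<and>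
             (\<forall>i\<in>I. lsc_on B (Ci i)))))"

text \<open>
  HOL cannot quantify existentially over the type of indices.  Index sets are therefore taken
  in the type of multifunctions itself.  This is no restriction, since every family can be
  re-indexed by its range; see \<open>admissibleI\<close> below.
\<close>

definition admissible ::
  "'a::topological_space measure \<Rightarrow> ('a \<Rightarrow> 'b::real_normed_vector set) \<Rightarrow> bool" where
  "admissible M C \<longleftrightarrow>
     (\<exists>(I :: ('a \<Rightarrow> 'b set) set) (Ci :: ('a \<Rightarrow> 'b set) \<Rightarrow> 'a \<Rightarrow> 'b set).
        uniform_Lusin_family M I Ci \<and>
        (\<forall>i\<in>I. \<forall>t. closed (Ci i t) \<and> convex (Ci i t)) \<and>
        (\<forall>t. C t = closure (\<Union>i\<in>I. Ci i t)))"

lemma admissibleI: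
  fixes I :: "'i set" and Ci :: "'i \<Rightarrow> 'a::topological_space \<Rightarrow> 'b::real_normed_vector set"
  assumes "uniform_Lusin_family M I Ci"
    and "\<And>i t. i \<in> I \<Longrightarrow> closed (Ci i t) \<and> convex (Ci i t)"
    and "\<And>t. C t = closure (\<Union>i\<in>I. Ci i t)"
  shows "admissible M C"
  unfolding admissible_def
proof (intro exI conjI)
  show "uniform_Lusin_family M (Ci ` I) id"
    using assms(1) by (simp add: uniform_Lusin_family_def)
qed (use assms(2,3) in auto)

end

theory Submission
  imports Defs
begin

text \<open>
  The set of values of an admissible multifunction may be far from separable, so a selection
  cannot be sought along a fixed dense sequence of \<open>X\<close>.  Compactness in \<open>T\<close> replaces it.
  If \<open>K\<close> is a compact set on which every \<open>C\<^sub>i\<close> is lower semicontinuous, then for open \<open>V\<close> the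
  set of \<open>t \<in> K\<close> at which \<open>C t\<close> hits \<open>V\<close> is relatively open in \<open>K\<close>: an open set hits the
  closure of a union iff it hits one of its members (\<open>closure_Union_hit_openin\<close>).  A compact
  metric space is second countable, so any union of such hitting sets is already the union of
  countably many of them, even where it is not all of \<open>K\<close>.  Hence at each stage countably many
  balls of a given radius suffice to find points near \<open>C t\<close>, for all \<open>t\<close> at once.

  This property survives countable unions of compact sets, and \<open>\<sigma>\<close>-finiteness together with
  the uniform Lusin property exhausts \<open>A\<close> by such a union \<open>S\<close> up to a null set
  (\<open>exhaust_up_to_null_set\<close>).  On \<open>S\<close> the construction of Kuratowski and Ryll-Nardzewski then goes
  through (\<open>measurable_selection\<close>): measurable functions \<open>f\<^sub>n\<close> with countable range are chosen so
  that the ball of radius \<open>2\<^sup>-\<^sup>n\<close> around \<open>f\<^sub>n t\<close> meets \<open>C t\<close>, each one near its predecessor.  Their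
  limit is a selection because the values are closed.  It is Borel measurable with values in the
  closure of a countable set, and such functions are strongly measurable
  (\<open>strongly_measurable_if_separable_range\<close>).
\<close>

section \<open>Strong measurability from separability of the range\<close>

text \<open>
  Enumerate \<open>Z\<close> as \<open>z\<^sub>0, z\<^sub>1, \<dots>\<close>.  The \<open>N\<close>-th approximation sends \<open>t\<close> to the point among
  \<open>z\<^sub>0, \<dots>, z\<^sub>N\<close> nearest to \<open>f t\<close>.
\<close>

lemma strongly_measurable_if_separable_range:
  fixes f :: "'a \<Rightarrow> 'b::metric_space"
  assumes f [measurable]: "f \<in> borel_measurable M"
    and Z: "countable Z" and sub: "f ` space M \<subseteq> closure Z"
  shows "strongly_measurable M f"
proof (cases "Z = {}")
  case True
  then have "space M = {}"
    using sub by auto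
  then show ?thesis
    by (auto simp: strongly_measurable_def simple_function_def)
next
  case False
  define z where "z = from_nat_into Z"
  have rng: "range z = Z"
    unfolding z_def using False Z by (rule range_from_nat_into)
  define nearest where
    "nearest N t k \<longleftrightarrow> k \<le> N \<and> (\<forall>j\<le>N. dist (z k) (f t) \<le> dist (z j) (f t))" for N t k
  \<comment> \<open>Ties go to the least index, which makes the choice measurable.\<close>
  define \<kappa> where "\<kappa> N t = (LEAST k. nearest N t k)" for N t
  have \<kappa>: "nearest N t (\<kappa> N t)" for N t
  proof -
    have "\<exists>k. is_arg_min (\<lambda>k. dist (z k) (f t)) (\<lambda>k. k \<in> {..N}) k"
      by (rule ex_is_arg_min_if_finite) auto
    then have "\<exists>k. nearest N t k"
      by (simp add: nearest_def is_arg_min_linorder)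
    then show ?thesis
      unfolding \<kappa>_def by (rule LeastI_ex)
  qed
  have [measurable]: "(\<lambda>t. dist p (f t)) \<in> borel_measurable M" for p
    by (rule measurable_compose[OF f], rule borel_measurable_continuous_onI)
      (intro continuous_intros)
  have meas: "\<kappa> N \<in> measurable M (count_space UNIV)" for N
    unfolding \<kappa>_def nearest_def by measurable
  have "simple_function M (\<lambda>t. z (\<kappa> N t))" for N
  proof -
    have "simple_function M (\<kappa> N)"
      unfolding simple_function_def
    proof (intro conjI ballI)
      have "\<kappa> N ` space M \<subseteq> {..N}"
        using \<kappa>[of N] by (simp add: nearest_def image_subset_iff)
      then show "finite (\<kappa> N ` space M)"
        by (rule finite_subset) simp
      show "\<kappa> N -` {k} \<inter> space M \<in> sets M" for k
        by (rule measurable_sets[OF meas]) simp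
    qed
    then show ?thesis
      by (rule simple_function_compose1)
  qed
  moreover have "(\<lambda>N. z (\<kappa> N t)) \<longlonglongrightarrow> f t" if "t \<in> space M" for t
  proof (rule metric_LIMSEQ_I)
    fix e :: real assume "e > 0"
    have "f t \<in> closure Z"
      using sub that by blast
    with \<open>e > 0\<close> obtain w where "w \<in> Z" "dist w (f t) < e"
      unfolding closure_approachable by blast
    moreover from \<open>w \<in> Z\<close> obtain j where "w = z j"
      unfolding rng[symmetric] by (rule rangeE)
    ultimately have j: "dist (z j) (f t) < e"
      by simp
    have "dist (z (\<kappa> N t)) (f t) < e" if "N \<ge> j" for N
    proof -
      have "dist (z (\<kappa> N t)) (f t) \<le> dist (z j) (f t)"
        using \<kappa>[of N t] that unfolding nearest_def by simp
      with j show ?thesis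
        by simp
    qed
    then show "\<exists>N0. \<forall>N\<ge>N0. dist (z (\<kappa> N t)) (f t) < e"
      by blast
  qed
  ultimately show ?thesis
    unfolding strongly_measurable_def by (intro exI[of _ "\<lambda>N t. z (\<kappa> N t)"]) blast
qed

section \<open>Measurable selections from multifunctions with the Lindelof property\<close>

text \<open>
  The last assumption takes the place of separability of the target space.  It concerns an
  arbitrary family \<open>\<V>\<close>, whose hitting sets need not cover \<open>S\<close>; this is why it can be applied to
  each level set of a function with countable range separately.
\<close>

locale Lindelof_multifunction =
  fixes M :: "'a measure" and S :: "'a set" and \<Phi> :: "'a \<Rightarrow> 'b::metric_space set"
  assumes S: "S \<in> sets M"
    and hit_measurable: "open V \<Longrightarrow> {t \<in> S. \<Phi> t \<inter> V \<noteq> {}} \<in> sets M"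
    and countable_hit: "(\<forall>V\<in>\<V>. open V) \<Longrightarrow>
      \<exists>\<W>\<subseteq>\<V>. countable \<W> \<and>
        (\<forall>t\<in>S. (\<exists>V\<in>\<V>. \<Phi> t \<inter> V \<noteq> {}) \<longrightarrow> (\<exists>W\<in>\<W>. \<Phi> t \<inter> W \<noteq> {}))"
begin

text \<open>
  One step of the iteration.  The label \<open>h t\<close> records what has been decided so far about the
  value at \<open>t\<close>, and the open set \<open>U (h t)\<close> is where that value has to lie.  Each of the countably
  many labels \<open>y\<close> needs only countably many centres \<open>z\<close> such that the sets \<open>U y \<inter> ball z e\<close> hit
  every relevant \<open>\<Phi> t\<close>; the first suitable centre in one enumeration of all of them is a
  measurable choice.
\<close>

lemma refine_selection:
  fixes h :: "'a \<Rightarrow> 'c" and U :: "'c \<Rightarrow> 'b set"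
  assumes h: "countable (range h)" "\<And>y. {t \<in> S. h t = y} \<in> sets M"
    and U: "\<And>y. open (U y)" "\<And>t. t \<in> S \<Longrightarrow> \<Phi> t \<inter> U (h t) \<noteq> {}"
    and "e > 0"
  shows "\<exists>f. countable (range f) \<and> (\<forall>t. t \<notin> S \<longrightarrow> f t = c) \<and> f \<in> borel_measurable M \<and>
           (\<forall>t\<in>S. \<Phi> t \<inter> U (h t) \<inter> ball (f t) e \<noteq> {})"
proof -
  have "\<exists>Z. countable Z \<and>
      (\<forall>t\<in>S. (\<exists>z. \<Phi> t \<inter> (U y \<inter> ball z e) \<noteq> {}) \<longrightarrow> (\<exists>z\<in>Z. \<Phi> t \<inter> (U y \<inter> ball z e) \<noteq> {}))" for y
  proof -
    have "\<forall>V\<in>range (\<lambda>z. U y \<inter> ball z e). open V"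
      using U(1) by auto
    from countable_hit[OF this] obtain \<W> where \<W>: "\<W> \<subseteq> range (\<lambda>z. U y \<inter> ball z e)"
        "countable \<W>" "\<forall>t\<in>S. (\<exists>V\<in>range (\<lambda>z. U y \<inter> ball z e). \<Phi> t \<inter> V \<noteq> {}) \<longrightarrow>
          (\<exists>W\<in>\<W>. \<Phi> t \<inter> W \<noteq> {})"
      by (elim exE conjE) (rule that)
    have "\<exists>Z. countable Z \<and> Z \<subseteq> UNIV \<and> \<W> = (\<lambda>z. U y \<inter> ball z e) ` Z"
      using \<W>(1,2) by (simp only: countable_subset_image[symmetric] simp_thms)
    then obtain Z where Z: "countable Z" "\<W> = (\<lambda>z. U y \<inter> ball z e) ` Z"
      by (elim exE conjE) (rule that)
    show ?thesis
      using Z(1) \<W>(3) unfolding Z(2) by (intro exI[of _ Z]) simp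
  qed
  then have "\<exists>Z. \<forall>y. countable (Z y) \<and>
      (\<forall>t\<in>S. (\<exists>z. \<Phi> t \<inter> (U y \<inter> ball z e) \<noteq> {}) \<longrightarrow> (\<exists>z\<in>Z y. \<Phi> t \<inter> (U y \<inter> ball z e) \<noteq> {}))"
    by (intro choice allI)
  then obtain Z where Z': "\<forall>y. countable (Z y) \<and>
      (\<forall>t\<in>S. (\<exists>z. \<Phi> t \<inter> (U y \<inter> ball z e) \<noteq> {}) \<longrightarrow> (\<exists>z\<in>Z y. \<Phi> t \<inter> (U y \<inter> ball z e) \<noteq> {}))"
    by (elim exE) (rule that)
  then have Z: "countable (Z y)" for y
    by blast
  have hit: "\<exists>z\<in>Z y. \<Phi> t \<inter> (U y \<inter> ball z e) \<noteq> {}"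
    if "t \<in> S" "\<exists>z. \<Phi> t \<inter> (U y \<inter> ball z e) \<noteq> {}" for t y
    using Z' that by simp
  define Y where "Y = insert c (\<Union>y\<in>range h. Z y)"
  have Y: "countable Y" "Y \<noteq> {}"
    unfolding Y_def using Z h(1) by (simp_all only: countable_insert_eq countable_UN insert_not_empty simp_thms)
  define z where "z = from_nat_into Y"
  have rng: "range z = Y"
    unfolding z_def using Y by (simp add: range_from_nat_into)
  define good where "good k t \<longleftrightarrow> \<Phi> t \<inter> (U (h t) \<inter> ball (z k) e) \<noteq> {}" for k t
  have ex: "\<exists>k. good k t" if "t \<in> S" for t
  proof -
    from U(2)[OF that] obtain w where w: "w \<in> \<Phi> t" "w \<in> U (h t)"
      by blast
    then have "\<exists>z. \<Phi> t \<inter> (U (h t) \<inter> ball z e) \<noteq> {}"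
      using \<open>e > 0\<close> by (intro exI[of _ w]) auto
    then obtain v where "v \<in> Z (h t)" "\<Phi> t \<inter> (U (h t) \<inter> ball v e) \<noteq> {}"
      using hit[OF \<open>t \<in> S\<close>] by blast
    moreover have "v \<in> range z"
      unfolding rng Y_def using \<open>v \<in> Z (h t)\<close> by blast
    ultimately show ?thesis
      unfolding good_def by blast
  qed
  have good_sets: "{t \<in> S. good k t} \<in> sets M" for k
  proof -
    have "{t \<in> S. good k t} =
        (\<Union>y\<in>range h. {t \<in> S. h t = y} \<inter> {t \<in> S. \<Phi> t \<inter> (U y \<inter> ball (z k) e) \<noteq> {}})"
      unfolding good_def by auto
    also have "\<dots> \<in> sets M"
      by (intro sets.countable_UN'' sets.Int hit_measurable h open_Int U(1) open_ball)
    finally show ?thesis .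
  qed
  have S_space: "S \<subseteq> space M"
    using S by (rule sets.sets_into_space)
  have pred_S [measurable]: "Measurable.pred M (\<lambda>t. t \<in> S)"
    using S by simp
  have pred_good [measurable]: "Measurable.pred M (\<lambda>t. t \<in> S \<and> good k t)" for k
  proof -
    have "{t \<in> space M. t \<in> S \<and> good k t} = {t \<in> S. good k t}"
      using S_space by blast
    then show ?thesis
      using good_sets by (simp add: pred_def)
  qed
  define \<kappa> where "\<kappa> t = (LEAST k. t \<in> S \<and> good k t)" for t
  have \<kappa>: "good (\<kappa> t) t" if "t \<in> S" for t
    unfolding \<kappa>_def using LeastI_ex[of "\<lambda>k. t \<in> S \<and> good k t"] ex[OF that] that by blast
  have meas: "\<kappa> \<in> measurable M (count_space UNIV)"
    unfolding \<kappa>_def by measurable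
  define f where "f t = (if t \<in> S then z (\<kappa> t) else c)" for t
  have "f \<in> borel_measurable M"
    unfolding f_def
  proof (rule measurable_If)
    show "(\<lambda>t. z (\<kappa> t)) \<in> borel_measurable M"
      using meas by (rule measurable_compose) simp
  qed (use pred_S in \<open>auto simp: pred_def\<close>)
  moreover have "countable (range f)"
    by (rule countable_subset[OF _ Y(1)]) (use rng in \<open>auto simp: f_def Y_def\<close>)
  moreover have "\<Phi> t \<inter> U (h t) \<inter> ball (f t) e \<noteq> {}" if "t \<in> S" for t
    using \<kappa>[OF that] that by (simp add: f_def good_def Int_assoc)
  ultimately show ?thesis
    by (intro exI[of _ f]) (auto simp: f_def)
qed

end

text \<open>
  The refinement step starts from the trivial label with \<open>U = UNIV\<close> and is then applied to
  \<open>f\<^sub>n\<close> itself with \<open>U y = ball y (2\<^sup>-\<^sup>n)\<close>.  A point of \<open>\<Phi> t\<close> common to the old ball and the new one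
  bounds the distance of consecutive approximations, so these form a Cauchy sequence.
\<close>

theorem measurable_selection:
  fixes \<Phi> :: "'a \<Rightarrow> 'b::complete_space set"
  assumes "Lindelof_multifunction M S \<Phi>"
    and cl: "\<And>t. t \<in> S \<Longrightarrow> closed (\<Phi> t)" and ne: "\<And>t. t \<in> S \<Longrightarrow> \<Phi> t \<noteq> {}"
  obtains x Z where "x \<in> borel_measurable M" "countable Z" "range x \<subseteq> closure Z"
    "\<forall>t\<in>S. x t \<in> \<Phi> t"
proof -
  interpret Lindelof_multifunction M S \<Phi>
    by fact
  define c :: 'b where "c = undefined"
  define P where "P n f \<longleftrightarrow> countable (range f) \<and> (\<forall>t. t \<notin> S \<longrightarrow> f t = c) \<and>
      f \<in> borel_measurable M \<and> (\<forall>t\<in>S. \<Phi> t \<inter> ball (f t) ((1/2)^n) \<noteq> {})" for n :: nat and f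
  define Q where "Q n f g \<longleftrightarrow>
      (\<forall>t\<in>S. \<Phi> t \<inter> ball (f t) ((1/2)^n) \<inter> ball (g t) ((1/2)^Suc n) \<noteq> {})"
    for n :: nat and f g :: "'a \<Rightarrow> 'b"
  have "\<exists>f. \<forall>n. P n (f n) \<and> Q n (f n) (f (Suc n))"
  proof (rule dependent_nat_choice)
    show "\<exists>f. P 0 f"
      using refine_selection[of "\<lambda>_. c" "\<lambda>_. UNIV" 1 c] S ne unfolding P_def by simp
  next
    fix f n assume f: "P n f"
    have "{t \<in> S. f t = y} \<in> sets M" for y
    proof -
      have "f -` {y} \<inter> space M \<in> sets M"
        using f unfolding P_def by (intro measurable_sets[of f M borel]) auto
      moreover have "{t \<in> S. f t = y} = (f -` {y} \<inter> space M) \<inter> S"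
        using sets.sets_into_space[OF S] by blast
      ultimately show ?thesis
        using S by simp
    qed
    then obtain g where g: "countable (range g)" "\<forall>t. t \<notin> S \<longrightarrow> g t = c" "g \<in> borel_measurable M"
      "\<forall>t\<in>S. \<Phi> t \<inter> ball (f t) ((1/2)^n) \<inter> ball (g t) ((1/2)^Suc n) \<noteq> {}"
      using refine_selection[of f "\<lambda>y. ball y ((1/2)^n)" "(1/2)^Suc n" c] f
      unfolding P_def by auto
    then have "P (Suc n) g" "Q n f g"
      unfolding P_def Q_def by (simp, blast, blast)
    then show "\<exists>g. P (Suc n) g \<and> Q n f g"
      by blast
  qed
  then obtain f where f: "\<And>n. P n (f n)" and Q: "\<And>n. Q n (f n) (f (Suc n))"
    by blast
  \<comment> \<open>Off \<open>S\<close> all \<open>f n\<close> equal \<open>c\<close>, so convergence holds everywhere and the limit is measurable on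
    the whole space.\<close>
  have step: "dist (f n t) (f (Suc n) t) \<le> 2 * (1/2)^n" for n t
  proof (cases "t \<in> S")
    case True
    then obtain w where "dist (f n t) w < (1/2)^n" "dist (f (Suc n) t) w < (1/2)^Suc n"
      using Q[of n] unfolding Q_def by fastforce
    moreover have "(1/2::real)^Suc n \<le> (1/2)^n"
      by simp
    ultimately show ?thesis
      using dist_triangle2[of "f n t" "f (Suc n) t" w] by linarith
  next
    case False
    then show ?thesis
      using f[of n] f[of "Suc n"] by (simp add: P_def)
  qed
  have "Cauchy (\<lambda>n. f n t)" for t
  proof -
    have tail: "dist (f m t) (f (m + k) t) \<le> 4 * (1/2)^m * (1 - (1/2)^k)" for m k
    proof (induction k)
      case (Suc k)
      have "dist (f m t) (f (m + Suc k) t) \<le> dist (f m t) (f (m + k) t) + 2 * (1/2)^(m + k)"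
        using dist_triangle[of "f m t" "f (m + Suc k) t" "f (m + k) t"] step[of "m + k" t] by simp
      with Suc show ?case
        by (simp add: power_add algebra_simps)
    qed simp
    have le: "dist (f m t) (f n t) \<le> 4 * (1/2)^m" if "m \<le> n" for m n
    proof -
      have "4 * (1/2)^m * (1 - (1/2)^(n - m)) \<le> 4 * (1/2::real)^m * 1"
        by (intro mult_left_mono) auto
      moreover have "dist (f m t) (f n t) \<le> 4 * (1/2)^m * (1 - (1/2)^(n - m))"
        using tail[of m "n - m"] that by simp
      ultimately show ?thesis
        by (simp only: mult_1_right)
    qed
    show ?thesis
    proof (rule metric_CauchyI)
      fix e :: real assume "e > 0"
      then obtain N where N: "(1/2)^N < e / 8"
        using real_arch_pow_inv[of "e / 8" "1/2"] by auto
      have "dist (f m t) (f n t) < e" if "m \<ge> N" "n \<ge> N" for m n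
        using le[OF that(1)] le[OF that(2)] N dist_triangle3[of "f m t" "f n t" "f N t"] by linarith
      then show "\<exists>N. \<forall>m\<ge>N. \<forall>n\<ge>N. dist (f m t) (f n t) < e"
        by blast
    qed
  qed
  then have "\<forall>t. \<exists>l. (\<lambda>n. f n t) \<longlonglongrightarrow> l"
    using Cauchy_convergent convergent_def by blast
  then obtain x where x: "\<And>t. (\<lambda>n. f n t) \<longlonglongrightarrow> x t"
    by metis
  define Z where "Z = (\<Union>n. range (f n))"
  show thesis
  proof
    show "x \<in> borel_measurable M"
    proof (rule borel_measurable_LIMSEQ_metric)
      show "f n \<in> borel_measurable M" for n
        using f[of n] by (simp add: P_def)
    qed (rule x)
    show "countable Z"
      unfolding Z_def using f by (intro countable_UN countableI_type) (simp add: P_def)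
    show "range x \<subseteq> closure Z"
    proof
      fix y assume "y \<in> range x"
      then obtain t where "y = x t"
        by blast
      moreover have "\<forall>n. f n t \<in> Z"
        by (auto simp: Z_def)
      ultimately show "y \<in> closure Z"
        using x[of t] unfolding closure_sequential by (intro exI[of _ "\<lambda>n. f n t"]) simp
    qed
    show "\<forall>t\<in>S. x t \<in> \<Phi> t"
    proof
      fix t assume t: "t \<in> S"
      have "\<exists>w. w \<in> \<Phi> t \<and> dist (f n t) w < (1/2)^n" for n
        using f[of n] t unfolding P_def by fastforce
      then obtain w where w: "\<And>n. w n \<in> \<Phi> t" "\<And>n. dist (f n t) (w n) < (1/2)^n"
        by metis
      have "(\<lambda>n. dist (w n) (x t)) \<longlonglongrightarrow> 0"
      proof (rule tendsto_sandwich[OF _ _ tendsto_const])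
        have "dist (w n) (x t) \<le> (1/2)^n + dist (f n t) (x t)" for n
          using dist_triangle3[of "w n" "x t" "f n t"] w(2)[of n] by linarith
        then show "\<forall>\<^sub>F n in sequentially. dist (w n) (x t) \<le> (1/2)^n + dist (f n t) (x t)"
          by simp
        have "(\<lambda>n. (1/2::real)^n + dist (f n t) (x t)) \<longlonglongrightarrow> 0 + 0"
          by (intro tendsto_add LIMSEQ_power_zero iffD1[OF tendsto_dist_iff] x) simp
        then show "(\<lambda>n. (1/2::real)^n + dist (f n t) (x t)) \<longlonglongrightarrow> 0"
          by simp
      qed simp
      then have "w \<longlonglongrightarrow> x t"
        by (rule iffD2[OF tendsto_dist_iff])
      then show "x t \<in> \<Phi> t"
        using closed_sequentially[OF cl[OF t]] w(1) by blast
    qed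
  qed
qed

section \<open>Lower semicontinuity on countably many compact sets\<close>

text \<open>
  Finite covers of \<open>K\<close> by balls of radius \<open>1/(n+1)\<close> provide a countable base of \<open>K\<close>.  It suffices
  to choose one \<open>G i\<close> for every basic set that is contained in some \<open>G i\<close>.
\<close>

lemma compact_metric_Lindelof:
  fixes K :: "'a::metric_space set"
  assumes K: "compact K" and G: "\<And>i. i \<in> I \<Longrightarrow> openin (top_of_set K) (G i)"
  obtains J where "J \<subseteq> I" "countable J" "(\<Union>i\<in>J. G i) = (\<Union>i\<in>I. G i)"
proof -
  have "\<exists>D. finite D \<and> D \<subseteq> K \<and> K \<subseteq> (\<Union>p\<in>D. ball p (inverse (Suc n)))" for n
    by (rule compactE_image[OF K, of K "\<lambda>p. ball p (inverse (Suc n))"])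
      (simp, force, blast)
  then obtain D where D: "\<And>n. finite (D n)" "\<And>n. K \<subseteq> (\<Union>p\<in>D n. ball p (inverse (Suc n)))"
    by metis
  define \<B> where "\<B> = (\<Union>n. (\<lambda>p. ball p (inverse (Suc n))) ` D n)"
  \<comment> \<open>\<open>B\<close> is a ball of the whole space, so its trace on \<open>K\<close> is what \<open>G i\<close> can contain.\<close>
  define \<B>' where "\<B>' = {B\<in>\<B>. \<exists>i\<in>I. B \<inter> K \<subseteq> G i}"
  have "countable \<B>"
    unfolding \<B>_def using D(1) by (intro countable_UN) (auto intro: countable_finite)
  then have \<B>': "countable \<B>'"
    unfolding \<B>'_def by simp
  from \<B>'_def have "\<forall>B\<in>\<B>'. \<exists>i. i \<in> I \<and> B \<inter> K \<subseteq> G i"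
    by blast
  then obtain \<iota> where \<iota>: "\<And>B. B \<in> \<B>' \<Longrightarrow> \<iota> B \<in> I" "\<And>B. B \<in> \<B>' \<Longrightarrow> B \<inter> K \<subseteq> G (\<iota> B)"
    by metis
  have "t \<in> (\<Union>i\<in>\<iota> ` \<B>'. G i)" if "i \<in> I" "t \<in> G i" for i t
  proof -
    from G[OF \<open>i \<in> I\<close>] have "G i \<subseteq> K"
      by (rule openin_imp_subset)
    with that have "t \<in> K"
      by blast
    from G[OF \<open>i \<in> I\<close>] \<open>t \<in> G i\<close> obtain e where e: "e > 0" "ball t e \<inter> K \<subseteq> G i"
      unfolding openin_contains_ball by blast
    then obtain n where n: "inverse (real (Suc n)) < e / 2"
      using reals_Archimedean[of "e / 2"] by auto
    obtain p where p: "p \<in> D n" "dist p t < inverse (Suc n)"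
      using D(2)[of n] \<open>t \<in> K\<close> by auto
    let ?B = "ball p (inverse (Suc n))"
    have "?B \<subseteq> ball t e"
    proof
      fix s assume "s \<in> ?B"
      then show "s \<in> ball t e"
        using n p(2) dist_triangle3[of t s p] by simp
    qed
    then have "?B \<in> \<B>'"
      unfolding \<B>'_def \<B>_def using e(2) p(1) \<open>i \<in> I\<close> by blast
    moreover have "t \<in> ?B \<inter> K"
      using p(2) \<open>t \<in> K\<close> by simp
    ultimately show ?thesis
      using \<iota>(2) by blast
  qed
  then have "(\<Union>i\<in>\<iota> ` \<B>'. G i) = (\<Union>i\<in>I. G i)"
    using \<iota>(1) by blast
  then show thesis
    using \<iota>(1) \<B>' by (intro that[of "\<iota> ` \<B>'"]) auto
qed

lemma lsc_on_hit_openin: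
  assumes "lsc_on B \<Phi>" "open V"
  shows "openin (top_of_set B) {t \<in> B. \<Phi> t \<inter> V \<noteq> {}}"
proof (subst openin_subopen, intro ballI)
  fix t assume t: "t \<in> {t \<in> B. \<Phi> t \<inter> V \<noteq> {}}"
  then have "\<Phi> t \<noteq> {}"
    by blast
  with assms t obtain U where U: "openin (top_of_set B) U" "t \<in> U" "\<forall>s\<in>U. \<Phi> s \<inter> V \<noteq> {}"
    unfolding lsc_on_def lsc_at_within_def by blast
  moreover have "U \<subseteq> B"
    using U(1) by (rule openin_imp_subset)
  ultimately show "\<exists>U. openin (top_of_set B) U \<and> t \<in> U \<and> U \<subseteq> {t \<in> B. \<Phi> t \<inter> V \<noteq> {}}"
    by blast
qed

lemma closure_Union_hit_openin:
  assumes "\<And>i. i \<in> I \<Longrightarrow> lsc_on B (Ci i)" "open V"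
  shows "openin (top_of_set B) {t \<in> B. closure (\<Union>i\<in>I. Ci i t) \<inter> V \<noteq> {}}"
proof -
  have "{t \<in> B. closure (\<Union>i\<in>I. Ci i t) \<inter> V \<noteq> {}} = (\<Union>i\<in>I. {t \<in> B. Ci i t \<inter> V \<noteq> {}})"
    using open_Int_closure_eq_empty[OF \<open>open V\<close>] by (auto simp: Int_commute)
  also have "openin (top_of_set B) \<dots>"
    using lsc_on_hit_openin[OF _ \<open>open V\<close>] assms(1) by (intro openin_Union) auto
  finally show ?thesis .
qed

lemma Lindelof_multifunction_countable_Union_compact:
  fixes M :: "'a::metric_space measure" and K :: "nat \<Rightarrow> 'a set"
  assumes borel: "sets borel \<subseteq> sets M" and K: "\<And>n. compact (K n)"
    and hit: "\<And>n V. open V \<Longrightarrow> openin (top_of_set (K n)) {t \<in> K n. \<Phi> t \<inter> V \<noteq> {}}"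
  shows "Lindelof_multifunction M (\<Union>n. K n) \<Phi>"
proof
  have K_sets: "K n \<in> sets M" for n
    using borel borel_closed[OF compact_imp_closed[OF K]] by blast
  then show "(\<Union>n. K n) \<in> sets M"
    by blast
  fix V :: "'b set" assume V: "open V"
  have "{t \<in> K n. \<Phi> t \<inter> V \<noteq> {}} \<in> sets M" for n
  proof -
    obtain W where "open W" "{t \<in> K n. \<Phi> t \<inter> V \<noteq> {}} = K n \<inter> W"
      using hit[OF V, of n] unfolding openin_open by blast
    moreover have "W \<in> sets M"
      using borel borel_open[OF \<open>open W\<close>] by blast
    ultimately show ?thesis
      using K_sets by simp
  qed
  moreover have "{t \<in> \<Union>n. K n. \<Phi> t \<inter> V \<noteq> {}} = (\<Union>n. {t \<in> K n. \<Phi> t \<inter> V \<noteq> {}})"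
    by blast
  ultimately show "{t \<in> \<Union>n. K n. \<Phi> t \<inter> V \<noteq> {}} \<in> sets M"
    by auto
next
  fix \<V> :: "'b set set" assume \<V>: "\<forall>V\<in>\<V>. open V"
  define H where "H n V = {t \<in> K n. \<Phi> t \<inter> V \<noteq> {}}" for n V
  have "\<exists>\<W>. \<W> \<subseteq> \<V> \<and> countable \<W> \<and> (\<Union>V\<in>\<W>. H n V) = (\<Union>V\<in>\<V>. H n V)" for n
  proof -
    have "openin (top_of_set (K n)) (H n V)" if "V \<in> \<V>" for V
      unfolding H_def using \<V> that by (intro hit) simp
    then obtain \<W> where "\<W> \<subseteq> \<V>" "countable \<W>" "(\<Union>V\<in>\<W>. H n V) = (\<Union>V\<in>\<V>. H n V)"
      by (rule compact_metric_Lindelof[of "K n" \<V> "H n", OF K])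
    then show ?thesis
      by (intro exI conjI)
  qed
  then obtain \<W> where \<W>: "\<And>n. \<W> n \<subseteq> \<V>" "\<And>n. countable (\<W> n)"
    "\<And>n. (\<Union>V\<in>\<W> n. H n V) = (\<Union>V\<in>\<V>. H n V)"
    by metis
  show "\<exists>\<W>\<subseteq>\<V>. countable \<W> \<and>
      (\<forall>t\<in>\<Union>n. K n. (\<exists>V\<in>\<V>. \<Phi> t \<inter> V \<noteq> {}) \<longrightarrow> (\<exists>W\<in>\<W>. \<Phi> t \<inter> W \<noteq> {}))"
  proof (intro exI[of _ "\<Union>n. \<W> n"] conjI ballI impI)
    show "(\<Union>n. \<W> n) \<subseteq> \<V>" "countable (\<Union>n. \<W> n)"
      using \<W>(1,2) by auto
    fix t assume "t \<in> (\<Union>n. K n)" and ex: "\<exists>V\<in>\<V>. \<Phi> t \<inter> V \<noteq> {}"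
    then obtain n where "t \<in> K n"
      by blast
    with ex have "t \<in> (\<Union>V\<in>\<V>. H n V)"
      by (simp add: H_def)
    then have "t \<in> (\<Union>V\<in>\<W> n. H n V)"
      by (simp only: \<W>(3))
    then show "\<exists>W\<in>\<Union>n. \<W> n. \<Phi> t \<inter> W \<noteq> {}"
      by (auto simp: H_def)
  qed
qed

text \<open>
  Within each piece of finite measure, the sets approximating it up to \<open>1/(k+1)\<close> jointly leave
  out only a null set; a pairing function lists the resulting double sequence as a single one.
\<close>

lemma (in sigma_finite_measure) exhaust_up_to_null_set:
  assumes A: "A \<in> sets M"
    and approx: "\<And>(\<epsilon>::real) E. \<epsilon> > 0 \<Longrightarrow> E \<in> sets M \<Longrightarrow> emeasure M E < \<infinity> \<Longrightarrow>
      \<exists>B. B \<in> sets M \<and> P B \<and> B \<subseteq> E \<and> emeasure M (E - B) < ennreal \<epsilon>"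
  obtains K :: "nat \<Rightarrow> 'a set" where "\<And>n. P (K n)" "\<And>n. K n \<subseteq> A" "A - (\<Union>n. K n) \<in> null_sets M"
proof -
  obtain F :: "nat \<Rightarrow> 'a set" where F: "range F \<subseteq> sets M" "(\<Union>i. F i) = space M"
    "\<And>i. emeasure M (F i) \<noteq> \<infinity>"
    using sigma_finite by metis
  define E where "E i = A \<inter> F i" for i
  have E: "E i \<in> sets M" for i
    using A F(1) by (auto simp: E_def)
  have fin: "emeasure M (E i) < \<infinity>" for i
  proof -
    have "emeasure M (E i) \<le> emeasure M (F i)"
      using F(1) by (intro emeasure_mono) (auto simp: E_def)
    then show ?thesis
      using F(3)[of i] by (simp add: less_top le_less_trans)
  qed
  have "\<exists>B. B \<in> sets M \<and> P B \<and> B \<subseteq> E i \<and> emeasure M (E i - B) < ennreal (inverse (real (Suc k)))"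
    for i k
    using approx[OF _ E fin, of "inverse (real (Suc k))" i] by simp
  then obtain B where B: "\<And>i k. B i k \<in> sets M" "\<And>i k. P (B i k)" "\<And>i k. B i k \<subseteq> E i"
    "\<And>i k. emeasure M (E i - B i k) < ennreal (inverse (real (Suc k)))"
    by metis
  have null: "E i - (\<Union>k. B i k) \<in> null_sets M" for i
  proof (rule null_setsI)
    show "E i - (\<Union>k. B i k) \<in> sets M"
      using B(1) by (intro sets.Diff E sets.countable_UN) auto
    have "emeasure M (E i - (\<Union>k. B i k)) \<le> ennreal (inverse (real (Suc k)))" for k
    proof -
      have "emeasure M (E i - (\<Union>k. B i k)) \<le> emeasure M (E i - B i k)"
        using E B(1) by (intro emeasure_mono) auto
      then show ?thesis
        using B(4)[of i k] by simp
    qed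
    moreover have "(\<lambda>k. ennreal (inverse (real (Suc k)))) \<longlonglongrightarrow> ennreal 0"
      by (intro tendsto_ennrealI LIMSEQ_inverse_real_of_nat)
    ultimately have "emeasure M (E i - (\<Union>k. B i k)) \<le> ennreal 0"
      by (intro LIMSEQ_le_const[of _ "ennreal 0"]) auto
    then show "emeasure M (E i - (\<Union>k. B i k)) = 0"
      by simp
  qed
  define K where "K n = case_prod B (prod_decode n)" for n
  have Un: "(\<Union>n. K n) = (\<Union>i. \<Union>k. B i k)"
  proof -
    have "(\<Union>n. K n) = (\<Union>p\<in>range prod_decode. case_prod B p)"
      by (simp add: K_def)
    then show ?thesis
      by (auto simp: surj_prod_decode)
  qed
  show thesis
  proof
    show "P (K n)" for n
      using B(2) by (simp add: K_def split_beta)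
    show "K n \<subseteq> A" for n
      using B(3) by (auto simp: K_def E_def split_beta)
    have "A = (\<Union>i. E i)"
      using sets.sets_into_space[OF A] F(2) by (auto simp: E_def)
    then have "A - (\<Union>n. K n) \<subseteq> (\<Union>i. E i - (\<Union>k. B i k))"
      unfolding Un by auto
    moreover have "(\<Union>i. E i - (\<Union>k. B i k)) \<in> null_sets M"
      using null by (rule null_sets_UN)
    moreover have "A - (\<Union>n. K n) \<in> sets M"
      unfolding Un using B(1) by (intro sets.Diff A sets.countable_UN) auto
    ultimately show "A - (\<Union>n. K n) \<in> null_sets M"
      using null_sets_subset by blast
  qed
qed

section \<open>Measurable selections of admissible multifunctions\<close>

theorem theorem5p5:
  fixes M :: "'a::metric_space measure"
    and C :: "'a \<Rightarrow> 'b::banach set"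
    and A :: "'a set"
  assumes "space M = UNIV"
    and "sets borel \<subseteq> sets M"
    and "complete_measure M"
    and "sigma_finite_measure M"
    and "inner_regular_measure M"
    and "admissible M C"
    and "A \<in> sets M"
    and "\<forall>t\<in>A. C t \<noteq> {}"
  shows "\<exists>x :: 'a \<Rightarrow> 'b. strongly_measurable (restrict_space M A) x \<and>
           (AE t in M. t \<in> A \<longrightarrow> x t \<in> C t)"
proof -
  interpret sigma_finite_measure M
    by fact
  obtain I :: "('a \<Rightarrow> 'b set) set" and Ci where
    Lusin: "uniform_Lusin_family M I Ci" and C: "\<And>t. C t = closure (\<Union>i\<in>I. Ci i t)"
    using \<open>admissible M C\<close> unfolding admissible_def by blast
  have "\<exists>B. B \<in> sets M \<and> (compact B \<and> (\<forall>i\<in>I. lsc_on B (Ci i))) \<and> B \<subseteq> E \<and>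
      emeasure M (E - B) < ennreal \<epsilon>"
    if "\<epsilon> > 0" "E \<in> sets M" "emeasure M E < \<infinity>" for \<epsilon> :: real and E
  proof -
    obtain B where B: "compact B" "B \<subseteq> E" "emeasure M (E - B) < ennreal \<epsilon>" "\<forall>i\<in>I. lsc_on B (Ci i)"
      using Lusin \<open>\<epsilon> > 0\<close> \<open>E \<in> sets M\<close> \<open>emeasure M E < \<infinity>\<close>
      unfolding uniform_Lusin_family_def by blast
    moreover have "B \<in> sets M"
      using assms(2) borel_closed[OF compact_imp_closed[OF B(1)]] by blast
    ultimately show ?thesis
      by blast
  qed
  then obtain K :: "nat \<Rightarrow> 'a set" where K: "\<And>n. compact (K n) \<and> (\<forall>i\<in>I. lsc_on (K n) (Ci i))"
    "\<And>n. K n \<subseteq> A" "A - (\<Union>n. K n) \<in> null_sets M"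
    using exhaust_up_to_null_set[OF \<open>A \<in> sets M\<close>,
        where P = "\<lambda>B. compact B \<and> (\<forall>i\<in>I. lsc_on B (Ci i))"] by blast
  have "openin (top_of_set (K n)) {t \<in> K n. C t \<inter> V \<noteq> {}}" if "open V" for n V
    unfolding C using K(1) that by (intro closure_Union_hit_openin) auto
  then have "Lindelof_multifunction M (\<Union>n. K n) C"
    using assms(2) K(1) by (intro Lindelof_multifunction_countable_Union_compact) auto
  moreover have "closed (C t)" for t
    by (simp add: C)
  moreover have "C t \<noteq> {}" if "t \<in> (\<Union>n. K n)" for t
    using that K(2) assms(8) by blast
  ultimately obtain x Z where x: "x \<in> borel_measurable M" "countable Z" "range x \<subseteq> closure Z"
    "\<forall>t\<in>(\<Union>n. K n). x t \<in> C t"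
    by (rule measurable_selection)
  have "strongly_measurable (restrict_space M A) x"
    using x by (intro strongly_measurable_if_separable_range[OF _ x(2)]
        measurable_restrict_space1) auto
  moreover have "AE t in M. t \<in> A \<longrightarrow> x t \<in> C t"
    by (rule AE_I'[OF K(3)]) (use x(4) in blast)
  ultimately show ?thesis
    by blast
qed

end
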